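(* Let $f:\mathbb{R}\to\mathbb{R}$ be continuous and bounded from above. Let $w(x,y):=\sup_{\alpha\in\mathcal{A}}\mathbb{E}^x[f(W(\tau^\alpha))]$, $(x,y)\in\mathbb{R}\times[0,\infty)$, and suppose $w$ is a viscosity solution of $$\begin{cases} u_y-\sup_{\alpha\in\mathbb{R}}\left[\frac12 u_{xx}+\alpha u_{xy}+\frac12\alpha^2u_{yy}\right]=0 & \text{in }\mathbb{R}\times(0,\infty),\\ u=f & \text{on }\mathbb{R}\times\{y=0\}.\end{cases}$$ If $w$ is smooth, then $w$ is a (classical) solution of $$\begin{cases} 2u_yu_{yy}-\det D^2u=0 & \text{in }\mathbb{R}\times(0,\infty),\\ u=f & \text{on }\mathbb{R}\times\{y=0\},\end{cases}$$ where $\det D^2u=u_{xx}u_{yy}-u_{xy}^2$.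
   Context: $W$ is a standard one-dimensional Brownian motion on a probability space $(\Omega,\mathcal{F},\mathbb{P})$, and $\mathbb{F}=\{\mathcal{F}_t\}_{t\ge 0}$ is its augmented canonical filtration. $\mathbb{P}^x$ (expectation $\mathbb{E}^x$) denotes the measure under which $W$ starts at $x\in\mathbb{R}$. $\mathcal{A}$ is the collection of all real-valued, progressively measurable processes $\alpha$ that are square-integrable, i.e. $\mathbb{E}^x\left[\int_0^\infty\alpha(s)^2\,ds\right]<\infty$. For $\alpha\in\mathcal{A}$ and $y\ge 0$, $\tau^\alpha:=\inf\{t\ge 0 : y-t+\int_0^t\alpha(s)\,dW(s)=0\}$. "Smooth" refers to smoothness in the open set $\mathbb{R}\times(0,\infty)$. Viscosity solutions (the supremum may be $+\infty$). For smooth $\phi$ write $L^\alpha\phi:=\frac12\phi_{xx}+\alpha\phi_{xy}+\frac12\alpha^2\phi_{yy}$. An upper semicontinuous function $u$ is a subsolution in $\mathbb{R}\times(0,\infty)$ if whenever $\phi$ is smooth and $u-\phi$ has a local maximum at $(x_0,y_0)\in\mathbb{R}\times(0,\infty)$, then for every $\eta>0$ there is $\alpha\in\mathbb{R}$ with $\phi_y(x_0,y_0)-L^\alpha\phi(x_0,y_0)\le\eta$. A lower semicontinuous function $u$ is a supersolution if whenever $\phi$ is smooth and $u-\phi$ has a local minimum at $(x_0,y_0)\in\mathbb{R}\times(0,\infty)$, then $\phi_y(x_0,y_0)-L^\alpha\phi(x_0,y_0)\ge 0$ for every $\alpha\in\mathbb{R}$. A locally bounded $u:\mathbb{R}\times[0,\infty)\to\mathbb{R}$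 is a viscosity solution of the boundary value problem if its upper semicontinuous envelope $u^*$ is a subsolution, its lower semicontinuous envelope $u_*$ is a supersolution, and $u^*=u_*=f$ on $\mathbb{R}\times\{0\}$ (envelopes taken on $\mathbb{R}\times[0,\infty)$). *)

theory Defs
  imports "HOL-Probability.Probability"
begin

definition brownian_motion :: "'w measure \<Rightarrow> (real \<Rightarrow> 'w \<Rightarrow> real) \<Rightarrow> real \<Rightarrow> bool" where
  "brownian_motion M W x \<longleftrightarrow>
     prob_space M \<and>
     (\<forall>t\<ge>0. W t \<in> borel_measurable M) \<and>
     (AE \<omega> in M. W 0 \<omega> = x) \<and>
     (AE \<omega> in M. continuous_on {0..} (\<lambda>t. W t \<omega>)) \<and>
     (\<forall>s t. 0 \<le> s \<and> s < t \<longrightarrow>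
        distributed M lborel (\<lambda>\<omega>. W t \<omega> - W s \<omega>) (normal_density 0 (sqrt (t - s)))) \<and>
     (\<forall>n t. 0 \<le> t 0 \<and> (\<forall>i<n. t i < t (Suc i)) \<longrightarrow>
        prob_space.indep_vars M (\<lambda>_. borel) (\<lambda>i \<omega>. W (t (Suc i)) \<omega> - W (t i) \<omega>) {..<n::nat})"

definition augmented_filtration :: "'w measure \<Rightarrow> (real \<Rightarrow> 'w \<Rightarrow> real) \<Rightarrow> real \<Rightarrow> 'w measure" where
  "augmented_filtration M W t =
     sigma (space M)
       ({W s -` B \<inter> space M | s B. 0 \<le> s \<and> s \<le> t \<and> B \<in> sets borel} \<union> null_sets (completion M))"

text \<open>Processes adapted to the augmented filtration are in general only measurable with respect to
  the completed measure, so all expectations are taken under the completion of \<open>M\<close>.\<close>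

definition progressively_measurable ::
    "(real \<Rightarrow> 'w measure) \<Rightarrow> (real \<Rightarrow> 'w \<Rightarrow> real) \<Rightarrow> bool" where
  "progressively_measurable F \<alpha> \<longleftrightarrow>
     (\<forall>t\<ge>0. (\<lambda>(s, \<omega>). \<alpha> s \<omega>) \<in> borel_measurable (restrict_space borel {0..t} \<Otimes>\<^sub>M F t))"

definition sq_norm :: "'w measure \<Rightarrow> (real \<Rightarrow> 'w \<Rightarrow> real) \<Rightarrow> ennreal" where
  "sq_norm M \<alpha> = (\<integral>\<^sup>+\<omega>. (\<integral>\<^sup>+s\<in>{0..}. ennreal ((\<alpha> s \<omega>)\<^sup>2) \<partial>lborel) \<partial>completion M)"

definition admissible :: "'w measure \<Rightarrow> (real \<Rightarrow> 'w \<Rightarrow> real) \<Rightarrow> (real \<Rightarrow> 'w \<Rightarrow> real) set" where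
  "admissible M W =
     {\<alpha>. progressively_measurable (augmented_filtration M W) \<alpha> \<and> sq_norm M \<alpha> < \<infinity>}"

text \<open>A triple \<open>(n, t, \<xi>)\<close> encodes the simple process that equals \<open>\<xi> i\<close> on the time interval
  \<open>(t i, t (Suc i)]\<close> for \<open>i < n\<close>, and 0 elsewhere.\<close>

definition is_simple ::
    "(real \<Rightarrow> 'w measure) \<Rightarrow> nat \<Rightarrow> (nat \<Rightarrow> real) \<Rightarrow> (nat \<Rightarrow> 'w \<Rightarrow> real) \<Rightarrow> bool" where
  "is_simple F n t \<xi> \<longleftrightarrow>
     0 \<le> t 0 \<and> (\<forall>i<n. t i < t (Suc i)) \<and>
     (\<forall>i<n. \<xi> i \<in> borel_measurable (F (t i)) \<and> bounded (\<xi> i ` space (F (t i))))"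

definition simple_process ::
    "nat \<Rightarrow> (nat \<Rightarrow> real) \<Rightarrow> (nat \<Rightarrow> 'w \<Rightarrow> real) \<Rightarrow> real \<Rightarrow> 'w \<Rightarrow> real" where
  "simple_process n t \<xi> s \<omega> = (\<Sum>i<n. \<xi> i \<omega> * indicator {t i<..t (Suc i)} s)"

definition simple_integral ::
    "(real \<Rightarrow> 'w \<Rightarrow> real) \<Rightarrow> nat \<Rightarrow> (nat \<Rightarrow> real) \<Rightarrow> (nat \<Rightarrow> 'w \<Rightarrow> real) \<Rightarrow> real \<Rightarrow> 'w \<Rightarrow> real" where
  "simple_integral W n t \<xi> r \<omega> =
     (\<Sum>i<n. \<xi> i \<omega> * (W (min r (t (Suc i))) \<omega> - W (min r (t i)) \<omega>))"

definition is_ito_integral ::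
    "'w measure \<Rightarrow> (real \<Rightarrow> 'w \<Rightarrow> real) \<Rightarrow> (real \<Rightarrow> 'w \<Rightarrow> real) \<Rightarrow> (real \<Rightarrow> 'w \<Rightarrow> real) \<Rightarrow> bool" where
  "is_ito_integral M W \<alpha> I \<longleftrightarrow>
     (\<forall>r\<ge>0. I r \<in> borel_measurable (augmented_filtration M W r)) \<and>
     (\<forall>\<omega>\<in>space M. continuous_on {0..} (\<lambda>r. I r \<omega>)) \<and>
     (\<exists>n t \<xi>.
        (\<forall>k::nat. is_simple (augmented_filtration M W) (n k) (t k) (\<xi> k)) \<and>
        (\<lambda>k. sq_norm M (\<lambda>s \<omega>. \<alpha> s \<omega> - simple_process (n k) (t k) (\<xi> k) s \<omega>)) \<longlonglongrightarrow> 0 \<and>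
        (\<forall>r\<ge>0. (\<lambda>k. \<integral>\<^sup>+\<omega>. ennreal ((I r \<omega> - simple_integral W (n k) (t k) (\<xi> k) r \<omega>)\<^sup>2)
                      \<partial>completion M) \<longlonglongrightarrow> 0))"

text \<open>The process characterised above exists for every admissible integrand and is unique up to
  indistinguishability, so the choice of version does not affect any expectation below.\<close>

definition ito_integral ::
    "'w measure \<Rightarrow> (real \<Rightarrow> 'w \<Rightarrow> real) \<Rightarrow> (real \<Rightarrow> 'w \<Rightarrow> real) \<Rightarrow> real \<Rightarrow> 'w \<Rightarrow> real" where
  "ito_integral M W \<alpha> = (SOME I. is_ito_integral M W \<alpha> I)"

definition exit_time ::
    "'w measure \<Rightarrow> (real \<Rightarrow> 'w \<Rightarrow> real) \<Rightarrow> (real \<Rightarrow> 'w \<Rightarrow> real) \<Rightarrow> real \<Rightarrow> 'w \<Rightarrow> ereal" where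
  "exit_time M W \<alpha> y \<omega> = Inf (ereal ` {t. 0 \<le> t \<and> y - t + ito_integral M W \<alpha> t \<omega> = 0})"

text \<open>The difference is well defined (not \<open>\<infinity> - \<infinity>\<close>) for integrands that are bounded from above;
  the value may be \<open>-\<infinity>\<close>.\<close>

definition ereal_expectation :: "'w measure \<Rightarrow> ('w \<Rightarrow> real) \<Rightarrow> ereal" where
  "ereal_expectation M g =
     enn2ereal (\<integral>\<^sup>+\<omega>. ennreal (g \<omega>) \<partial>completion M)
       - enn2ereal (\<integral>\<^sup>+\<omega>. ennreal (- g \<omega>) \<partial>completion M)"

text \<open>\<open>P x\<close> is the measure under which \<open>W\<close> starts at \<open>x\<close>. The exit time is almost surely finite
  (its expectation is at most \<open>y\<close>), so the value of \<open>real_of_ereal\<close> at \<open>\<infinity>\<close> is irrelevant.\<close>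

definition value_function ::
    "(real \<Rightarrow> 'w measure) \<Rightarrow> (real \<Rightarrow> 'w \<Rightarrow> real) \<Rightarrow> (real \<Rightarrow> real) \<Rightarrow> real \<Rightarrow> real \<Rightarrow> ereal" where
  "value_function P W f x y =
     (SUP \<alpha>\<in>admissible (P x) W.
        ereal_expectation (P x) (\<lambda>\<omega>. f (W (real_of_ereal (exit_time (P x) W \<alpha> y \<omega>)) \<omega>)))"

definition partial_x :: "(real \<times> real \<Rightarrow> real) \<Rightarrow> real \<times> real \<Rightarrow> real" where
  "partial_x u z = deriv (\<lambda>s. u (s, snd z)) (fst z)"

definition partial_y :: "(real \<times> real \<Rightarrow> real) \<Rightarrow> real \<times> real \<Rightarrow> real" where
  "partial_y u z = deriv (\<lambda>s. u (fst z, s)) (snd z)"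

definition partial_xx :: "(real \<times> real \<Rightarrow> real) \<Rightarrow> real \<times> real \<Rightarrow> real" where
  "partial_xx u = partial_x (partial_x u)"

definition partial_xy :: "(real \<times> real \<Rightarrow> real) \<Rightarrow> real \<times> real \<Rightarrow> real" where
  "partial_xy u = partial_y (partial_x u)"

definition partial_yy :: "(real \<times> real \<Rightarrow> real) \<Rightarrow> real \<times> real \<Rightarrow> real" where
  "partial_yy u = partial_y (partial_y u)"

primrec Ck_on :: "nat \<Rightarrow> (real \<times> real) set \<Rightarrow> (real \<times> real \<Rightarrow> real) \<Rightarrow> bool" where
  "Ck_on 0 S u = continuous_on S u"
| "Ck_on (Suc k) S u =
     ((\<forall>(x, y)\<in>S. (\<lambda>s. u (s, y)) differentiable (at x) \<and> (\<lambda>s. u (x, s)) differentiable (at y)) \<and>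
      Ck_on k S (partial_x u) \<and> Ck_on k S (partial_y u))"

definition smooth_on :: "(real \<times> real) set \<Rightarrow> (real \<times> real \<Rightarrow> real) \<Rightarrow> bool" where
  "smooth_on S u \<longleftrightarrow> (\<forall>k. Ck_on k S u)"

definition open_half_plane :: "(real \<times> real) set" where
  "open_half_plane = UNIV \<times> {0<..}"

definition closed_half_plane :: "(real \<times> real) set" where
  "closed_half_plane = UNIV \<times> {0..}"

definition generator :: "real \<Rightarrow> (real \<times> real \<Rightarrow> real) \<Rightarrow> real \<times> real \<Rightarrow> real" where
  "generator a u z = 1/2 * partial_xx u z + a * partial_xy u z + 1/2 * a\<^sup>2 * partial_yy u z"

definition usc_on :: "'a::topological_space set \<Rightarrow> ('a \<Rightarrow> real) \<Rightarrow> bool" where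
  "usc_on D u \<longleftrightarrow> (\<forall>z\<in>D. \<forall>c>u z. \<forall>\<^sub>F p in at z within D. u p < c)"

definition lsc_on :: "'a::topological_space set \<Rightarrow> ('a \<Rightarrow> real) \<Rightarrow> bool" where
  "lsc_on D u \<longleftrightarrow> (\<forall>z\<in>D. \<forall>c<u z. \<forall>\<^sub>F p in at z within D. c < u p)"

definition subsolution :: "(real \<times> real \<Rightarrow> real) \<Rightarrow> bool" where
  "subsolution u \<longleftrightarrow>
     usc_on closed_half_plane u \<and>
     (\<forall>\<phi> z. smooth_on open_half_plane \<phi> \<and> z \<in> open_half_plane \<and>
        (\<forall>\<^sub>F p in nhds z. u p - \<phi> p \<le> u z - \<phi> z) \<longrightarrow>
        (\<forall>\<eta>>0. \<exists>a. partial_y \<phi> z - generator a \<phi> z \<le> \<eta>))"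

definition supersolution :: "(real \<times> real \<Rightarrow> real) \<Rightarrow> bool" where
  "supersolution u \<longleftrightarrow>
     lsc_on closed_half_plane u \<and>
     (\<forall>\<phi> z. smooth_on open_half_plane \<phi> \<and> z \<in> open_half_plane \<and>
        (\<forall>\<^sub>F p in nhds z. u p - \<phi> p \<ge> u z - \<phi> z) \<longrightarrow>
        (\<forall>a. partial_y \<phi> z - generator a \<phi> z \<ge> 0))"

definition locally_bounded_on :: "'a::metric_space set \<Rightarrow> ('a \<Rightarrow> real) \<Rightarrow> bool" where
  "locally_bounded_on D u \<longleftrightarrow> (\<forall>z\<in>D. \<exists>r>0. bounded (u ` (ball z r \<inter> D)))"

text \<open>The infimum and supremum are formed in \<open>ereal\<close> because \<open>u\<close> may be unbounded on large balls;
  for locally bounded \<open>u\<close> the result is finite at every point of \<open>D\<close>.\<close>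

definition usc_envelope :: "'a::metric_space set \<Rightarrow> ('a \<Rightarrow> real) \<Rightarrow> 'a \<Rightarrow> real" where
  "usc_envelope D u z = real_of_ereal (INF r\<in>{0<..}. SUP p\<in>ball z r \<inter> D. ereal (u p))"

definition lsc_envelope :: "'a::metric_space set \<Rightarrow> ('a \<Rightarrow> real) \<Rightarrow> 'a \<Rightarrow> real" where
  "lsc_envelope D u z = real_of_ereal (SUP r\<in>{0<..}. INF p\<in>ball z r \<inter> D. ereal (u p))"

definition viscosity_solution :: "(real \<Rightarrow> real) \<Rightarrow> (real \<times> real \<Rightarrow> real) \<Rightarrow> bool" where
  "viscosity_solution f u \<longleftrightarrow>
     locally_bounded_on closed_half_plane u \<and>
     subsolution (usc_envelope closed_half_plane u) \<and>
     supersolution (lsc_envelope closed_half_plane u) \<and>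
     (\<forall>x. usc_envelope closed_half_plane u (x, 0) = f x \<and>
          lsc_envelope closed_half_plane u (x, 0) = f x)"

definition det_hessian :: "(real \<times> real \<Rightarrow> real) \<Rightarrow> real \<times> real \<Rightarrow> real" where
  "det_hessian u z = partial_xx u z * partial_yy u z - (partial_xy u z)\<^sup>2"

definition classical_solution :: "(real \<Rightarrow> real) \<Rightarrow> (real \<times> real \<Rightarrow> real) \<Rightarrow> bool" where
  "classical_solution f u \<longleftrightarrow>
     Ck_on 2 open_half_plane u \<and>
     continuous_on closed_half_plane u \<and>
     (\<forall>z\<in>open_half_plane. 2 * partial_y u z * partial_yy u z - det_hessian u z = 0) \<and>
     (\<forall>x. u (x, 0) = f x)"

end

theory Submission
  imports Defs
begin

text \<open>A smooth \<open>w\<close> is continuous, hence equal to its envelopes in the open half plane, and \<open>\<phi> = w\<close> is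
  itself an admissible test function at every interior point. So the quadratic
  \<open>a \<mapsto> w\<^sub>y - w\<^sub>x\<^sub>x / 2 - a w\<^sub>x\<^sub>y - a\<^sup>2 w\<^sub>y\<^sub>y / 2\<close> has infimum 0. Either \<open>w\<^sub>y\<^sub>y < 0\<close> and the infimum is
  attained at \<open>a = - w\<^sub>x\<^sub>y / w\<^sub>y\<^sub>y\<close>, where vanishing is the claimed equation, or
  \<open>w\<^sub>y\<^sub>y = w\<^sub>x\<^sub>y = 0\<close> and the equation is trivial. At the boundary, the agreement of both envelopes with
  \<open>f\<close> amounts to continuity of \<open>w\<close>.\<close>

text \<open>Negation swaps suprema and infima, so facts about lower envelopes follow from those
  about upper envelopes.\<close>

lemma lsc_envelope_eq_uminus: "lsc_envelope D u z = - usc_envelope D (\<lambda>p. - u p) z"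
proof -
  have "(INF r\<in>{0<..}. SUP p\<in>ball z r \<inter> D. ereal (- u p))
      = - (SUP r\<in>{0<..}. INF p\<in>ball z r \<inter> D. ereal (u p))"
    by (simp add: ereal_SUP_uminus_eq ereal_INF_uminus_eq flip: uminus_ereal.simps)
  then show ?thesis
    by (simp add: lsc_envelope_def usc_envelope_def)
qed

lemma locally_bounded_on_uminus:
  assumes "locally_bounded_on D u"
  shows "locally_bounded_on D (\<lambda>p. - u p)"
  using assms unfolding locally_bounded_on_def bounded_iff by fastforce

text \<open>Local boundedness keeps the infimum below \<infinity>; the value \<open>u z\<close>,
  which enters every supremum because \<open>z \<in> D\<close>, keeps it above -\<infinity>. Hence
  \<open>real_of_ereal\<close> loses nothing.\<close>

lemma usc_envelope_eq_ereal:
  assumes "locally_bounded_on D u" "z \<in> D"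
  shows "ereal (usc_envelope D u z) = (INF r\<in>{0<..}. SUP p\<in>ball z r \<inter> D. ereal (u p))"
    (is "_ = ?E")
proof -
  obtain r B where "r > 0" and B: "\<And>p. p \<in> ball z r \<inter> D \<Longrightarrow> \<bar>u p\<bar> \<le> B"
    using assms unfolding locally_bounded_on_def bounded_iff by (metis imageI real_norm_def)
  have "?E \<le> (SUP p\<in>ball z r \<inter> D. ereal (u p))"
    using \<open>r > 0\<close> by (intro INF_lower) auto
  also have "\<dots> \<le> ereal B"
    using B by (intro SUP_least) (auto simp: abs_le_iff)
  finally have "?E \<noteq> \<infinity>" by auto
  moreover have "ereal (u z) \<le> ?E"
    using assms by (intro INF_greatest SUP_upper) auto
  then have "?E \<noteq> -\<infinity>" by auto
  ultimately show ?thesis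
    unfolding usc_envelope_def by (intro ereal_real') auto
qed

lemma usc_envelope_ge:
  assumes "locally_bounded_on D u" "z \<in> D"
  shows "u z \<le> usc_envelope D u z"
proof -
  have "ereal (u z) \<le> ereal (usc_envelope D u z)"
    unfolding usc_envelope_eq_ereal[OF assms] using assms(2)
    by (intro INF_greatest SUP_upper) auto
  then show ?thesis by simp
qed

lemma eventually_less_if_usc_envelope_less:
  assumes "locally_bounded_on D u" "z \<in> D" "usc_envelope D u z < c"
  shows "\<forall>\<^sub>F p in at z within D. u p < c"
proof -
  have "(INF r\<in>{0<..}. SUP p\<in>ball z r \<inter> D. ereal (u p)) < ereal c"
    using assms(3) by (simp flip: usc_envelope_eq_ereal[OF assms(1,2)])
  then obtain r where "r > 0" and r: "(SUP p\<in>ball z r \<inter> D. ereal (u p)) < ereal c"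
    by (auto simp: INF_less_iff)
  have "u p < c" if "p \<in> ball z r \<inter> D" for p
    using le_less_trans[OF SUP_upper[OF that] r] by simp
  then show ?thesis
    using \<open>r > 0\<close> by (auto simp: eventually_at dist_commute intro!: exI[of _ r])
qed

lemma usc_envelope_eq_if_continuous:
  assumes "locally_bounded_on D u" "z \<in> D" "continuous (at z within D) u"
  shows "usc_envelope D u z = u z"
proof (rule antisym)
  show "usc_envelope D u z \<le> u z"
  proof (rule field_le_epsilon)
    fix e :: real assume "e > 0"
    then obtain r where "r > 0" and r: "\<And>p. p \<in> D \<Longrightarrow> dist p z < r \<Longrightarrow> dist (u p) (u z) < e"
      using assms(3) unfolding continuous_within_eps_delta by blast
    have "ereal (usc_envelope D u z) \<le> (SUP p\<in>ball z r \<inter> D. ereal (u p))"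
      unfolding usc_envelope_eq_ereal[OF assms(1,2)] using \<open>r > 0\<close> by (intro INF_lower) auto
    also have "\<dots> \<le> ereal (u z + e)"
    proof (rule SUP_least)
      fix p assume "p \<in> ball z r \<inter> D"
      then show "ereal (u p) \<le> ereal (u z + e)"
        using r[of p] by (auto simp: dist_commute dist_real_def)
    qed
    finally show "usc_envelope D u z \<le> u z + e" by simp
  qed
qed (use assms usc_envelope_ge in blast)

lemma lsc_envelope_eq_if_continuous:
  assumes "locally_bounded_on D u" "z \<in> D" "continuous (at z within D) u"
  shows "lsc_envelope D u z = u z"
  using usc_envelope_eq_if_continuous[OF locally_bounded_on_uminus[OF assms(1)] assms(2)]
    continuous_minus[OF assms(3)]
  by (simp add: lsc_envelope_eq_uminus)

text \<open>\<open>u z\<close> is squeezed between the two envelopes. The upper one bounds nearby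
  values from above, the lower one from below, so equal envelopes force convergence to
  \<open>l\<close>.\<close>

lemma envelopes_agree_imp:
  assumes u: "locally_bounded_on D u" and z: "z \<in> D"
    and env: "usc_envelope D u z = l" "lsc_envelope D u z = l"
  shows "u z = l" and "continuous (at z within D) u"
proof -
  note u' = locally_bounded_on_uminus[OF u]
  show eq: "u z = l"
    using usc_envelope_ge[OF u z] usc_envelope_ge[OF u' z] env
    by (simp add: lsc_envelope_eq_uminus)
  have "\<forall>\<^sub>F p in at z within D. u p < c" if "l < c" for c
    using eventually_less_if_usc_envelope_less[OF u z] env that by simp
  moreover have "\<forall>\<^sub>F p in at z within D. c < u p" if "c < l" for c
    using eventually_less_if_usc_envelope_less[OF u' z, of "- c"] env that
    by (simp add: lsc_envelope_eq_uminus)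
  ultimately show "continuous (at z within D) u"
    unfolding continuous_within eq by (intro order_tendstoI)
qed

text \<open>The algebraic core, with \<open>D\<close>, \<open>A\<close>, \<open>B\<close>,
  \<open>C\<close> standing for the derivatives \<open>w\<^sub>y\<close>,
  \<open>w\<^sub>x\<^sub>x\<close>, \<open>w\<^sub>x\<^sub>y\<close>,
  \<open>w\<^sub>y\<^sub>y\<close> at a fixed point.\<close>

lemma quadratic_inf_zero_imp:
  fixes A B C D :: real
  assumes nonneg: "\<And>a. 0 \<le> D - (1/2 * A + a * B + 1/2 * a\<^sup>2 * C)"
    and approx: "\<And>\<eta>. \<eta> > 0 \<Longrightarrow> \<exists>a. D - (1/2 * A + a * B + 1/2 * a\<^sup>2 * C) \<le> \<eta>"
  shows "2 * D * C - (A * C - B\<^sup>2) = 0"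
proof (cases "C = 0")
  case True
  have "B = 0"
  proof (rule ccontr)
    assume "B \<noteq> 0"
    then show False
      \<comment> \<open>For \<open>C = 0\<close> the expression is affine in \<open>a\<close>; at
        this point it equals -1.\<close>
      using nonneg[of "(D - 1/2 * A + 1) / B"] True by (simp add: field_simps)
  qed
  with True show ?thesis by simp
next
  case False
  \<comment> \<open>Completing the square: the constant term, named \<open>m\<close> below, is the
    left-hand side of the goal divided by \<open>2 * C\<close>, so it remains to show
    \<open>m = 0\<close>.\<close>
  have square: "D - (1/2 * A + a * B + 1/2 * a\<^sup>2 * C)
      = (2 * D * C - (A * C - B\<^sup>2)) / (2 * C) - (C / 2) * (a + B / C)\<^sup>2" for a
    using False by (simp add: field_simps power2_eq_square)
  define m where "m = (2 * D * C - (A * C - B\<^sup>2)) / (2 * C)"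
  have "m \<ge> 0"
    using nonneg[of "- B / C"] unfolding square m_def by simp
  have "C < 0"
  proof (rule ccontr)
    assume "\<not> C < 0"
    with False have "C > 0" by simp
    \<comment> \<open>Chosen so that \<open>(C / 2) * s\<close> exceeds \<open>m\<close>. As
      \<open>s \<ge> 1\<close>, so does \<open>(C / 2) * s\<^sup>2\<close>, and the quadratic is
      negative at \<open>s - B / C\<close>.\<close>
    define s where "s = 2 * m / C + 1"
    have "s \<ge> 1" using \<open>C > 0\<close> \<open>m \<ge> 0\<close> by (simp add: s_def)
    then have "(C / 2) * s \<le> (C / 2) * s\<^sup>2"
      using \<open>C > 0\<close> by (intro mult_left_mono) (auto simp: power2_eq_square)
    moreover have "(C / 2) * s = m + C / 2"
      using \<open>C > 0\<close> by (simp add: s_def field_simps)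
    moreover have "(C / 2) * s\<^sup>2 \<le> m"
      using nonneg[of "s - B / C"] unfolding square m_def[symmetric] by simp
    ultimately show False using \<open>C > 0\<close> by linarith
  qed
  \<comment> \<open>For \<open>C < 0\<close> the square only adds to \<open>m\<close>, so
    \<open>m\<close> is a lower bound of values that come arbitrarily close to 0 or below.\<close>
  have "m \<le> 0"
  proof (rule field_le_epsilon)
    fix e :: real assume "e > 0"
    then obtain a where "m - (C / 2) * (a + B / C)\<^sup>2 \<le> e"
      using approx[of e] unfolding square m_def by blast
    moreover have "(C / 2) * (a + B / C)\<^sup>2 \<le> 0"
      using \<open>C < 0\<close> by (intro mult_nonpos_nonneg) auto
    ultimately show "m \<le> 0 + e" by simp
  qed
  with \<open>m \<ge> 0\<close> show ?thesis using False by (simp add: m_def)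
qed

lemma open_open_half_plane: "open open_half_plane"
  by (auto simp: open_half_plane_def intro: open_Times)

text \<open>The half plane is open, so continuity there is unrestricted and \<open>S\<close> is
  arbitrary; \<open>closed_half_plane\<close> is the case of interest, as the envelopes are taken
  over it.\<close>

lemma smooth_on_imp_continuous_within:
  assumes "smooth_on open_half_plane u" "p \<in> open_half_plane"
  shows "continuous (at p within S) u"
proof -
  have "continuous_on open_half_plane u"
    using assms(1) unfolding smooth_on_def by (metis Ck_on.simps(1))
  then show ?thesis
    using assms(2) open_open_half_plane
    by (auto simp: continuous_on_eq_continuous_at intro: continuous_at_imp_continuous_within)
qed

lemma smooth_viscosity_solution_equation:
  assumes v: "viscosity_solution f w" and s: "smooth_on open_half_plane w"
    and z: "z \<in> open_half_plane"
  shows "2 * partial_y w z * partial_yy w z - det_hessian w z = 0"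
proof -
  have sub: "open_half_plane \<subseteq> closed_half_plane"
    by (auto simp: open_half_plane_def closed_half_plane_def)
  have lb: "locally_bounded_on closed_half_plane w"
    using v by (simp add: viscosity_solution_def)
  note cont = smooth_on_imp_continuous_within[OF s]
  have env: "usc_envelope closed_half_plane w p = w p" "lsc_envelope closed_half_plane w p = w p"
    if "p \<in> open_half_plane" for p
    using usc_envelope_eq_if_continuous[OF lb _ cont] lsc_envelope_eq_if_continuous[OF lb _ cont]
      that sub by blast+
  have near: "\<forall>\<^sub>F p in nhds z. p \<in> open_half_plane"
    using open_open_half_plane z by (rule eventually_nhds_in_open)
  \<comment> \<open>With \<open>w\<close> as its own test function the difference vanishes near
    \<open>z\<close>, which is thus both a local maximum and a local minimum.\<close>
  have "\<forall>\<^sub>F p in nhds z. usc_envelope closed_half_plane w p - w p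
      \<le> usc_envelope closed_half_plane w z - w z"
    using near by eventually_elim (simp add: env z)
  then have le: "\<exists>a. partial_y w z - generator a w z \<le> \<eta>" if "\<eta> > 0" for \<eta>
    using v s z that unfolding viscosity_solution_def subsolution_def by blast
  have "\<forall>\<^sub>F p in nhds z. lsc_envelope closed_half_plane w p - w p
      \<ge> lsc_envelope closed_half_plane w z - w z"
    using near by eventually_elim (simp add: env z)
  then have ge: "0 \<le> partial_y w z - generator a w z" for a
    using v s z unfolding viscosity_solution_def supersolution_def by blast
  show ?thesis
    unfolding det_hessian_def
    using ge le unfolding generator_def by (rule quadratic_inf_zero_imp)
qed

lemma viscosity_solution_boundary:
  assumes "viscosity_solution f w"
  shows "w (x, 0) = f x" and "continuous (at (x, 0) within closed_half_plane) w"
proof -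
  have "(x, 0) \<in> closed_half_plane" by (simp add: closed_half_plane_def)
  then show "w (x, 0) = f x" "continuous (at (x, 0) within closed_half_plane) w"
    using assms envelopes_agree_imp[of closed_half_plane w "(x, 0)" "f x"]
    by (auto simp: viscosity_solution_def)
qed

theorem proposition3:
  fixes P :: "real \<Rightarrow> 'w measure"
    and W :: "real \<Rightarrow> 'w \<Rightarrow> real"
    and f :: "real \<Rightarrow> real"
    and w :: "real \<times> real \<Rightarrow> real"
  assumes "\<And>x. brownian_motion (P x) W x"
    and "\<And>x. sets (P x) = sets (P 0)"
    and "continuous_on UNIV f"
    and "bdd_above (range f)"
    and "\<And>x y. 0 \<le> y \<Longrightarrow> ereal (w (x, y)) = value_function P W f x y"
    and "viscosity_solution f w"
    and "smooth_on open_half_plane w"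
  shows "classical_solution f w"
proof -
  note v = \<open>viscosity_solution f w\<close> and s = \<open>smooth_on open_half_plane w\<close>
  have "continuous_on closed_half_plane w"
    unfolding continuous_on_eq_continuous_within
  proof
    fix p assume "p \<in> closed_half_plane"
    \<comment> \<open>Interior points are covered by smoothness, boundary points by the agreement of
      the envelopes.\<close>
    then consider "p \<in> open_half_plane" | "p = (fst p, 0)"
      by (cases p) (force simp: open_half_plane_def closed_half_plane_def)
    then show "continuous (at p within closed_half_plane) w"
      using smooth_on_imp_continuous_within[OF s] viscosity_solution_boundary(2)[OF v] by cases metis+
  qed
  moreover have "Ck_on 2 open_half_plane w"
    using s by (simp add: smooth_on_def)
  ultimately show ?thesis
    using smooth_viscosity_solution_equation[OF v s] viscosity_solution_boundary(1)[OF v]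
    by (simp add: classical_solution_def)
qed

end
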